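(* Let $[q_0; q_1, q_2, \ldots]$ be a (finite or infinite) continued fraction with $q_0$ a non-negative integer and $q_i$ a positive integer for every $i \ge 1$, and let $A_n/B_n$ be its $n$-th convergent. For each index $n \ge 0$ for which $q_n$ is defined, let $W_n = R^{q_0} L^{q_1} R^{q_2} \cdots$ be the product of $n+1$ blocks with exponents $q_0, q_1, \ldots, q_n$, alternating between $R$ and $L$ and starting with $R$. If $W_n$ ends with an $R$-move (i.e. its last block is $R^{q_n}$), then $$W_n = \begin{pmatrix} A_{n-1} & A_n \\ B_{n-1} & B_n \end{pmatrix}.$$ Otherwise, if $W_n$ ends with an $L$-move (i.e. its last block is $L^{q_n}$), then $$W_n = \begin{pmatrix} A_n & A_{n-1} \\ B_n & B_{n-1} \end{pmatrix}.$$
   Context: $R = \begin{pmatrix} 1 & 1 \\ 0 & 1 \end{pmatrix}$ and $L = \begin{pmatrix} 1 & 0 \\ 1 & 1 \end{pmatrix}$. A path in the matrix binary tree starts at the $2\times 2$ identity matrix; an $R$-move (resp. $L$-move) is post-multiplication by $R$ (resp. $L$). The path attached to $q_0, \ldots, q_n$ makes $q_0$ $R$-moves, then $q_1$ $L$-moves, then $q_2$ $R$-moves, and so on, alternating direction after each term; it is identified with the resulting matrix $W_n$. Thus the last block is $R^{q_n}$ when $n$ is even and $L^{q_n}$ when $n$ is odd. $[q_0; q_1, q_2, \ldots]$ denotes the continued fraction $q_0 + \cfrac{1}{q_1 + \cfrac{1}{q_2 + \ddots}}$. Its $n$-th convergent is $A_n/B_n = [q_0; q_1, \ldots, q_n]$,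 where the numerators and denominators are given by $A_n = q_n A_{n-1} + A_{n-2}$ and $B_n = q_n B_{n-1} + B_{n-2}$ for $n \ge 1$, with initial values $A_{-1} = 1$, $A_0 = q_0$, $B_{-1} = 0$, $B_0 = 1$. *)

theory Defs
  imports "Jordan_Normal_Form.Matrix" "HOL-Library.Extended_Nat" Complex_Main
begin

datatype move = R_move | L_move

fun move_mat :: "move \<Rightarrow> int mat" where
  "move_mat R_move = mat_of_rows_list 2 [[1, 1], [0, 1]]"
| "move_mat L_move = mat_of_rows_list 2 [[1, 0], [1, 1]]"

definition block_move :: "nat \<Rightarrow> move" where
  "block_move n = (if even n then R_move else L_move)"

fun path_mat :: "(nat \<Rightarrow> nat) \<Rightarrow> nat \<Rightarrow> int mat" where
  "path_mat q 0 = 1\<^sub>m 2 * move_mat (block_move 0) ^\<^sub>m q 0"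
| "path_mat q (Suc n) = path_mat q n * move_mat (block_move (Suc n)) ^\<^sub>m q (Suc n)"

text \<open>Numerators and denominators of the convergents are indexed by integers so that the
  index \<open>-1\<close> is available; the values at indices below \<open>-1\<close> are junk.\<close>

function cf_num :: "(nat \<Rightarrow> nat) \<Rightarrow> int \<Rightarrow> int" where
  "cf_num q k =
     (if k \<le> -1 then 1
      else if k = 0 then int (q 0)
      else int (q (nat k)) * cf_num q (k - 1) + cf_num q (k - 2))"
  by pat_completeness auto
termination by (relation "measure (\<lambda>(q, k). nat (k + 1))") auto

function cf_den :: "(nat \<Rightarrow> nat) \<Rightarrow> int \<Rightarrow> int" where
  "cf_den q k =
     (if k \<le> -1 then 0
      else if k = 0 then 1
      else int (q (nat k)) * cf_den q (k - 1) + cf_den q (k - 2))"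
  by pat_completeness auto
termination by (relation "measure (\<lambda>(q, k). nat (k + 1))") auto

declare cf_num.simps [simp del] cf_den.simps [simp del]

lemma cf_num_simps:
  "cf_num q (-1) = 1"
  "cf_num q 0 = int (q 0)"
  "n \<ge> 1 \<Longrightarrow> cf_num q (int n) = int (q n) * cf_num q (int n - 1) + cf_num q (int n - 2)"
  by (subst cf_num.simps; simp)+

lemma cf_den_simps:
  "cf_den q (-1) = 0"
  "cf_den q 0 = 1"
  "n \<ge> 1 \<Longrightarrow> cf_den q (int n) = int (q n) * cf_den q (int n - 1) + cf_den q (int n - 2)"
  by (subst cf_den.simps; simp)+

text \<open>The value of a finite continued fraction; \<open>cf_num\<close> and \<open>cf_den\<close> compute it.\<close>

fun cf_value :: "real list \<Rightarrow> real" where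
  "cf_value [] = 0"
| "cf_value [x] = x"
| "cf_value (x # y # zs) = x + 1 / cf_value (y # zs)"

lemma cf_value_snoc2: "cf_value (xs @ [a, x]) = cf_value (xs @ [a + 1 / x])"
proof (induction xs)
  case (Cons b xs)
  then show ?case by (cases xs) auto
qed simp

lemma cf_den_nonneg: "cf_den q k \<ge> 0"
  by (induction q k rule: cf_den.induct) (subst cf_den.simps, auto)

lemma cf_den_pos:
  assumes "\<And>i. 1 \<le> i \<Longrightarrow> i \<le> n \<Longrightarrow> 0 < q i"
  shows "cf_den q (int n) > 0"
  using assms
proof (induction n)
  case (Suc n)
  then have "0 < int (q (Suc n)) * cf_den q (int n)" by simp
  then show ?case
    using cf_den_simps(3)[of "Suc n" q] cf_den_nonneg[of q "int (Suc n) - 2"] by simp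
qed (simp add: cf_den_simps)

lemma cf_value_snoc:
  assumes "\<And>i. 1 \<le> i \<Longrightarrow> i \<le> n \<Longrightarrow> 0 < q i" and "x > 0"
  shows "cf_value (map (\<lambda>i. real (q i)) [0..<Suc n] @ [x]) =
    (x * cf_num q (int n) + cf_num q (int n - 1)) / (x * cf_den q (int n) + cf_den q (int n - 1))"
  using assms
proof (induction n arbitrary: x)
  case 0
  then show ?case by (simp add: cf_num_simps cf_den_simps field_simps)
next
  case (Suc n)
  define y where "y = real (q (Suc n)) + 1 / x"
  have y: "y > 0" using Suc.prems by (simp add: y_def add_nonneg_pos)
  have "cf_value (map (\<lambda>i. real (q i)) [0..<Suc (Suc n)] @ [x])
      = cf_value (map (\<lambda>i. real (q i)) [0..<Suc n] @ [y])"
    using cf_value_snoc2[of "map (\<lambda>i. real (q i)) [0..<Suc n]" "real (q (Suc n))" x]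
    by (simp add: y_def)
  also have "\<dots> = (y * cf_num q (int n) + cf_num q (int n - 1))
      / (y * cf_den q (int n) + cf_den q (int n - 1))"
    using Suc y by simp
  also have "\<dots> = (x * (y * cf_num q (int n) + cf_num q (int n - 1)))
      / (x * (y * cf_den q (int n) + cf_den q (int n - 1)))"
    using Suc.prems(2) by simp
  also have "x * (y * cf_num q (int n) + cf_num q (int n - 1))
      = x * cf_num q (int (Suc n)) + cf_num q (int (Suc n) - 1)"
    using Suc.prems(2) cf_num_simps(3)[of "Suc n" q] by (simp add: y_def field_simps)
  also have "x * (y * cf_den q (int n) + cf_den q (int n - 1))
      = x * cf_den q (int (Suc n)) + cf_den q (int (Suc n) - 1)"
    using Suc.prems(2) cf_den_simps(3)[of "Suc n" q] by (simp add: y_def field_simps)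
  finally show ?case .
qed

lemma convergent_eq_cf_value:
  assumes "\<And>i. 1 \<le> i \<Longrightarrow> i \<le> n \<Longrightarrow> 0 < q i"
  shows "cf_num q (int n) / cf_den q (int n) = cf_value (map (\<lambda>i. real (q i)) [0..<Suc n])"
proof (cases n)
  case 0
  then show ?thesis by (simp add: cf_num_simps cf_den_simps)
next
  case (Suc m)
  then show ?thesis
    using assms cf_value_snoc[of m q "real (q n)"] cf_num_simps(3)[of n q] cf_den_simps(3)[of n q]
    by simp
qed

end

theory Submission
  imports Defs
begin

text \<open>Multiplying on the right by R^k adds k times the first column to the second; L^k adds k
  times the second column to the first (\<open>R_move_pow\<close>, \<open>L_move_pow\<close>). With
  k = q_n, this is the recurrence shared by A and B: the column of the newest convergent stays, and
  the older one is overwritten by its successor. The directions alternate, so the newest column is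
  the second for even n and the first for odd n; induction on n gives
  \<open>path_mat_eq\<close>.\<close>

lemma mat_of_rows_list_2_mult:
  fixes a b c d e f g h :: "'a :: semiring_0"
  shows "mat_of_rows_list 2 [[a, b], [c, d]] * mat_of_rows_list 2 [[e, f], [g, h]] =
    mat_of_rows_list 2 [[a * e + b * g, a * f + b * h], [c * e + d * g, c * f + d * h]]"
  by (rule eq_matI) (auto simp: mat_of_rows_list_def scalar_prod_def
      numeral_2_eq_2 less_Suc_eq)

lemma one_mat_2: "1\<^sub>m 2 = mat_of_rows_list 2 [[1, 0], [0, 1]]"
  by (rule eq_matI) (auto simp: mat_of_rows_list_def numeral_2_eq_2 less_Suc_eq)

text \<open>The zeroth power of a matrix is the identity of size \<open>dim_row\<close>; this fixes
  that size in the base cases below.\<close>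

lemma dim_row_move_mat: "dim_row (move_mat m) = 2"
  by (cases m) (simp_all add: mat_of_rows_list_def)

text \<open>R is a shear I + N with N * N = 0, so each factor raises the off-diagonal entry by
  one.\<close>

lemma R_move_pow: "move_mat R_move ^\<^sub>m k = mat_of_rows_list 2 [[1, int k], [0, 1]]"
proof (induction k)
  case 0
  show ?case by (simp add: dim_row_move_mat one_mat_2 del: move_mat.simps)
qed (simp add: mat_of_rows_list_2_mult)

lemma L_move_pow: "move_mat L_move ^\<^sub>m k = mat_of_rows_list 2 [[1, 0], [int k, 1]]"
proof (induction k)
  case 0
  show ?case by (simp add: dim_row_move_mat one_mat_2 del: move_mat.simps)
qed (simp add: mat_of_rows_list_2_mult add.commute)

lemma path_mat_eq:
  "path_mat q n =
    (if even n
     then mat_of_rows_list 2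
       [[cf_num q (int n - 1), cf_num q (int n)], [cf_den q (int n - 1), cf_den q (int n)]]
     else mat_of_rows_list 2
       [[cf_num q (int n), cf_num q (int n - 1)], [cf_den q (int n), cf_den q (int n - 1)]])"
proof (induction n)
  case 0
  \<comment> \<open>Here R^(q_0) has columns (1, 0) and (q_0, 1), which are exactly the initial
    values at indices -1 and 0.\<close>
  show ?case
    by (simp add: block_move_def R_move_pow one_mat_2 mat_of_rows_list_2_mult
        cf_num_simps cf_den_simps del: move_mat.simps)
next
  case (Suc n)
  then show ?case
    \<comment> \<open>At \<open>Suc n\<close> the recurrence refers to the indices n and n - 1, the
      two columns supplied by the induction hypothesis.\<close>
    using cf_num_simps(3)[of "Suc n" q] cf_den_simps(3)[of "Suc n" q]
    by (simp add: block_move_def R_move_pow L_move_pow mat_of_rows_list_2_mult algebra_simps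
        del: move_mat.simps)
qed

theorem theorem1:
  fixes q :: "nat \<Rightarrow> nat" and len :: enat and n :: nat
  assumes "\<And>i. i \<ge> 1 \<Longrightarrow> enat i < len \<Longrightarrow> q i > 0"
    and "enat n < len"
  shows "(block_move n = R_move \<longrightarrow>
            path_mat q n = mat_of_rows_list 2
              [[cf_num q (int n - 1), cf_num q (int n)],
               [cf_den q (int n - 1), cf_den q (int n)]]) \<and>
         (block_move n = L_move \<longrightarrow>
            path_mat q n = mat_of_rows_list 2
              [[cf_num q (int n), cf_num q (int n - 1)],
               [cf_den q (int n), cf_den q (int n - 1)]])"
  by (simp add: path_mat_eq block_move_def)

end
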